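(* Let $m,n\ge 2$ be integers, let $r_1,\dots,r_m,t_1,\dots,t_n\in(0,1)$, and let $E\in\mathcal S(r_1,\dots,r_m)$ and $F\in\mathcal S(t_1,\dots,t_n)$. Let $s=\dim_H E/\dim_H F$, and let $E'\in\mathcal S(r_1^s,\dots,r_m^s)$. Then $E$ and $F$ are strictly Hölder equivalent if and only if $E'$ and $F$ are Lipschitz equivalent.
   Context: For $r_1,\dots,r_m\in(0,1)$, $\mathcal S(r_1,\dots,r_m)$ denotes the collection of self-similar sets (in some Euclidean space $\mathbb R^d$, $d\ge 1$, with the Euclidean metric) with contraction ratios $r_1,\dots,r_m$ satisfying the strong separation condition. That is, $K\in\mathcal S(r_1,\dots,r_m)$ if there are similitudes $\varphi_1,\dots,\varphi_m$ of $\mathbb R^d$, with $\varphi_j$ of ratio $r_j$ (so $|\varphi_j(x)-\varphi_j(y)|=r_j|x-y|$), such that $K$ is the unique nonempty compact set with $K=\bigcup_{j=1}^m\varphi_j(K)$, and $\varphi_i(K)\cap\varphi_j(K)=\emptyset$ whenever $i\ne j$. $\dim_H$ denotes Hausdorff dimension. Strict Hölder equivalence: metric spaces $(X,d_X)$ and $(Y,d_Y)$ are strictly Hölder equivalent if there are a bijection $f:X\to Y$ and constants $s,C>0$ such that $$C^{-1}d_X(x_1,x_2)^s\le d_Y(f(x_1),f(x_2))\le C\,d_X(x_1,x_2)^s\quad\text{for all }x_1,x_2\in X.$$ They are Lipschitz equivalent if this holds for some bijection $f$ and some $C>0$ with $s=1$. *)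

theory Defs
  imports "HOL-Analysis.Analysis"
begin

section \<open>Hausdorff measure and dimension\<close>

text \<open>
  The \<open>s\<close>-th power of the diameter, with the usual convention that for \<open>s = 0\<close> every nonempty
  set has weight 1 (the library has \<open>0 powr 0 = 0\<close>, which would give the wrong
  zero-dimensional measure).
\<close>

definition diam_powr :: "real \<Rightarrow> 'a::metric_space set \<Rightarrow> ennreal" where
  "diam_powr s U =
     (if U = {} then 0 else if s = 0 then 1 else ennreal (diameter U powr s))"

text \<open>
  Covers consist of bounded sets, because \<^const>\<open>diameter\<close> is only meaningful for those.
  Finite covers are included, since the covering sets may be empty. If there is no
  \<open>\<delta>\<close>-cover, the infimum is \<open>\<infinity>\<close>.
\<close>

definition hausdorff_premeasure :: "real \<Rightarrow> real \<Rightarrow> 'a::metric_space set \<Rightarrow> ennreal" where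
  "hausdorff_premeasure \<delta> s A =
     (INF U \<in> {U :: nat \<Rightarrow> 'a set. A \<subseteq> (\<Union>i. U i) \<and> (\<forall>i. bounded (U i) \<and> diameter (U i) \<le> \<delta>)}.
        \<Sum>i. diam_powr s (U i))"

definition hausdorff_measure :: "real \<Rightarrow> 'a::metric_space set \<Rightarrow> ennreal" where
  "hausdorff_measure s A = (SUP \<delta>\<in>{0<..}. hausdorff_premeasure \<delta> s A)"

text \<open>
  Restricted to Euclidean spaces, where the infimum is over a nonempty set (every \<open>s > DIM('a)\<close>
  belongs to it), so that the dimension is a genuine real number.
\<close>

definition hausdorff_dim :: "'a::euclidean_space set \<Rightarrow> real" where
  "hausdorff_dim A = Inf {s. 0 \<le> s \<and> hausdorff_measure s A = 0}"


section \<open>Self-similar sets\<close>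

definition similitude :: "real \<Rightarrow> ('a::metric_space \<Rightarrow> 'a) \<Rightarrow> bool" where
  "similitude \<rho> f \<longleftrightarrow> (\<forall>x y. dist (f x) (f y) = \<rho> * dist x y)"

definition invariant_compact :: "nat \<Rightarrow> (nat \<Rightarrow> 'a \<Rightarrow> 'a) \<Rightarrow> 'a::metric_space set \<Rightarrow> bool" where
  "invariant_compact m \<phi> K \<longleftrightarrow> K \<noteq> {} \<and> compact K \<and> K = (\<Union>j\<in>{1..m}. \<phi> j ` K)"

text \<open>
  The class \<open>S(r\<^sub>1, \<dots>, r\<^sub>m)\<close> of self-similar sets in the Euclidean space \<open>'a\<close>, under the strong
  separation condition; only \<open>r 1, \<dots>, r m\<close> matter.
\<close>

definition self_similar_sets :: "nat \<Rightarrow> (nat \<Rightarrow> real) \<Rightarrow> 'a::euclidean_space set set" where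
  "self_similar_sets m r =
     {K. \<exists>\<phi> :: nat \<Rightarrow> 'a \<Rightarrow> 'a.
        (\<forall>j\<in>{1..m}. similitude (r j) (\<phi> j)) \<and>
        invariant_compact m \<phi> K \<and> (\<forall>L. invariant_compact m \<phi> L \<longrightarrow> L = K) \<and>
        (\<forall>i\<in>{1..m}. \<forall>j\<in>{1..m}. i \<noteq> j \<longrightarrow> \<phi> i ` K \<inter> \<phi> j ` K = {})}"


section \<open>Equivalence of metric spaces\<close>

text \<open>The metric spaces are subsets with the restricted metric.\<close>

definition bi_hoelder_map ::
    "real \<Rightarrow> real \<Rightarrow> ('a::metric_space \<Rightarrow> 'b::metric_space) \<Rightarrow> 'a set \<Rightarrow> 'b set \<Rightarrow> bool" where
  "bi_hoelder_map s C f X Y \<longleftrightarrow>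
     bij_betw f X Y \<and>
     (\<forall>x1\<in>X. \<forall>x2\<in>X. inverse C * dist x1 x2 powr s \<le> dist (f x1) (f x2) \<and>
                     dist (f x1) (f x2) \<le> C * dist x1 x2 powr s)"

definition strictly_hoelder_equivalent ::
    "'a::metric_space set \<Rightarrow> 'b::metric_space set \<Rightarrow> bool" where
  "strictly_hoelder_equivalent X Y \<longleftrightarrow> (\<exists>f s C. s > 0 \<and> C > 0 \<and> bi_hoelder_map s C f X Y)"

definition lipschitz_equivalent ::
    "'a::metric_space set \<Rightarrow> 'b::metric_space set \<Rightarrow> bool" where
  "lipschitz_equivalent X Y \<longleftrightarrow> (\<exists>f C. C > 0 \<and> bi_hoelder_map 1 C f X Y)"

end

theory Submission
  imports Defs
begin

text \<open>
  Matching symbolic codings gives a bijection \<open>E \<rightarrow> E'\<close> which is bi-Hoelder with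
  exponent \<open>s\<close>, because the distance of two points of a separated self-similar set is comparable to
  the product of the ratios along the longest common prefix of their codes. Composing with this
  bijection turns a strict Hoelder equivalence \<open>E \<rightarrow> F\<close> of exponent \<open>s\<close> into a Lipschitz equivalence
  \<open>E' \<rightarrow> F\<close> and conversely. The exponent of any strict Hoelder equivalence \<open>E \<rightarrow> F\<close> must be
  \<open>s\<close>, since such a map scales Hausdorff dimension by its exponent. That \<open>s\<close> is
  positive, so that neither dimension vanishes, is forced by the existence of \<open>E'\<close>.
\<close>

section \<open>Bi-Hoelder maps\<close>

text \<open>Solving each of the two bounds for \<open>dist x y\<close> and taking
  \<open>1 / s\<close>-th powers exchanges their roles, so the same constant
  \<open>C powr (1 / s)\<close> serves on both sides.\<close>

lemma bi_hoelder_map_inv_into: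
  assumes "bi_hoelder_map s C f X Y" "s > 0" "C > 0"
  shows "bi_hoelder_map (1 / s) (C powr (1 / s)) (inv_into X f) Y X"
proof -
  have bij: "bij_betw f X Y"
    and lo: "\<And>x y. x \<in> X \<Longrightarrow> y \<in> X \<Longrightarrow> inverse C * dist x y powr s \<le> dist (f x) (f y)"
    and up: "\<And>x y. x \<in> X \<Longrightarrow> y \<in> X \<Longrightarrow> dist (f x) (f y) \<le> C * dist x y powr s"
    using assms unfolding bi_hoelder_map_def by blast+
  have "inverse (C powr (1 / s)) * dist (f x) (f y) powr (1 / s) \<le> dist x y \<and>
        dist x y \<le> C powr (1 / s) * dist (f x) (f y) powr (1 / s)" if "x \<in> X" "y \<in> X" for x y
  proof
    have "dist (f x) (f y) powr (1 / s) \<le> (C * dist x y powr s) powr (1 / s)"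
      using up[OF that] assms by (intro powr_mono2) auto
    also have "\<dots> = C powr (1 / s) * dist x y"
      using assms by (simp add: powr_mult powr_powr)
    finally show "inverse (C powr (1 / s)) * dist (f x) (f y) powr (1 / s) \<le> dist x y"
      using assms by (simp add: field_simps)
    have "dist x y powr s \<le> C * dist (f x) (f y)"
      using lo[OF that] assms by (simp add: field_simps)
    then have "(dist x y powr s) powr (1 / s) \<le> (C * dist (f x) (f y)) powr (1 / s)"
      using assms by (intro powr_mono2) auto
    then show "dist x y \<le> C powr (1 / s) * dist (f x) (f y) powr (1 / s)"
      using assms by (simp add: powr_mult powr_powr)
  qed
  then show ?thesis
    unfolding bi_hoelder_map_def
    using bij bij_betw_inv_into[OF bij] bij_betw_inv_into_right[OF bij]
    by (metis bij_betw_apply)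
qed

text \<open>The bounds for \<open>f\<close> are raised to the power \<open>s'\<close> before they
  enter those for \<open>g\<close>. Hence the exponents multiply and \<open>C\<close> contributes
  \<open>C powr s'\<close>.\<close>

lemma bi_hoelder_map_comp:
  assumes f: "bi_hoelder_map s C f X Y" and g: "bi_hoelder_map s' C' g Y Z"
    and pos: "s' > 0" "C > 0" "C' > 0"
  shows "bi_hoelder_map (s * s') (C' * C powr s') (g \<circ> f) X Z"
  unfolding bi_hoelder_map_def
proof (intro conjI ballI)
  show "bij_betw (g \<circ> f) X Z"
    using f g unfolding bi_hoelder_map_def by (blast intro: bij_betw_trans)
  fix x y assume xy: "x \<in> X" "y \<in> X"
  then have Y: "f x \<in> Y" "f y \<in> Y"
    using f unfolding bi_hoelder_map_def by (auto dest: bij_betw_apply)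
  have "(inverse C * dist x y powr s) powr s' \<le> dist (f x) (f y) powr s'"
    using f xy pos unfolding bi_hoelder_map_def by (intro powr_mono2) auto
  then have "inverse C' * (inverse (C powr s') * dist x y powr (s * s'))
      \<le> inverse C' * dist (f x) (f y) powr s'"
    using pos by (intro mult_left_mono) (auto simp: powr_mult powr_powr inverse_powr powr_minus)
  also have "\<dots> \<le> dist (g (f x)) (g (f y))"
    using g Y unfolding bi_hoelder_map_def by blast
  finally show "inverse (C' * C powr s') * dist x y powr (s * s') \<le> dist ((g \<circ> f) x) ((g \<circ> f) y)"
    by (simp add: mult_ac)
  have "dist (g (f x)) (g (f y)) \<le> C' * dist (f x) (f y) powr s'"
    using g Y unfolding bi_hoelder_map_def by blast
  also have "\<dots> \<le> C' * (C * dist x y powr s) powr s'"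
    using f xy pos unfolding bi_hoelder_map_def by (intro mult_left_mono powr_mono2) auto
  finally show "dist ((g \<circ> f) x) ((g \<circ> f) y) \<le> C' * C powr s' * dist x y powr (s * s')"
    using pos by (simp add: powr_mult powr_powr mult_ac)
qed


section \<open>Hausdorff dimension under bi-Hoelder maps\<close>

text \<open>The condition \<open>0 \<le> d\<close> takes care of the empty set, whose diameter is
  0.\<close>

lemma diameter_le_metric:
  fixes S :: "'a::metric_space set"
  assumes "0 \<le> d" "\<And>x y. x \<in> S \<Longrightarrow> y \<in> S \<Longrightarrow> dist x y \<le> d"
  shows "bounded S" "diameter S \<le> d"
proof -
  show "bounded S"
    using assms(2) unfolding bounded_def by blast
  show "diameter S \<le> d"
    using assms by (auto simp: diameter_def intro!: cSUP_least)
qed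

text \<open>A cover of \<open>X\<close> is pushed forward by \<open>f\<close>. Its members are first
  intersected with \<open>X\<close>, because the Hoelder bound holds only there. The condition
  relating \<open>\<delta>'\<close> to \<open>\<delta>\<close> makes the images fine enough.\<close>

lemma hausdorff_premeasure_image_le:
  fixes f :: "'a::metric_space \<Rightarrow> 'b::metric_space"
  assumes f: "\<And>x y. x \<in> X \<Longrightarrow> y \<in> X \<Longrightarrow> dist (f x) (f y) \<le> C * dist x y powr s"
    and pos: "s > 0" "C > 0" "t \<ge> 0" and \<delta>: "C * \<delta>' powr s \<le> \<delta>"
    and U: "X \<subseteq> (\<Union>i::nat. U i)" "\<And>i. bounded (U i)" "\<And>i. diameter (U i) \<le> \<delta>'"
  shows "hausdorff_premeasure \<delta> t (f ` X) \<le> ennreal (C powr t) * (\<Sum>i. diam_powr (s * t) (U i))"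
proof -
  define V where "V i = f ` (U i \<inter> X)" for i
  have V: "bounded (V i)" "diameter (V i) \<le> C * diameter (U i) powr s" for i
  proof -
    have "dist x y \<le> C * diameter (U i) powr s" if xy: "x \<in> V i" "y \<in> V i" for x y
    proof -
      obtain u v where uv: "u \<in> U i" "u \<in> X" "x = f u" "v \<in> U i" "v \<in> X" "y = f v"
        using xy unfolding V_def by blast
      have "dist x y \<le> C * dist u v powr s" using f uv by blast
      also have "\<dots> \<le> C * diameter (U i) powr s"
        using uv pos diameter_bounded_bound[OF U(2)] by (intro mult_left_mono powr_mono2) auto
      finally show ?thesis .
    qed
    then show "bounded (V i)" "diameter (V i) \<le> C * diameter (U i) powr s"
      using pos by (auto intro!: diameter_le_metric[of "C * diameter (U i) powr s"])
  qed
  have "diameter (V i) \<le> \<delta>" for i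
  proof -
    have "C * diameter (U i) powr s \<le> C * \<delta>' powr s"
      using pos U diameter_ge_0[OF U(2)] by (intro mult_left_mono powr_mono2) auto
    with V(2)[of i] \<delta> show ?thesis by linarith
  qed
  then have "hausdorff_premeasure \<delta> t (f ` X) \<le> (\<Sum>i. diam_powr t (V i))"
    unfolding hausdorff_premeasure_def using V(1) U(1)
    by (intro INF_lower) (fastforce simp: V_def)
  also have "\<dots> \<le> (\<Sum>i. ennreal (C powr t) * diam_powr (s * t) (U i))"
  proof (intro suminf_le allI summableI)
    fix i
    show "diam_powr t (V i) \<le> ennreal (C powr t) * diam_powr (s * t) (U i)"
    \<comment> \<open>These are the special cases of \<open>diam_powr\<close>: an empty image has
      weight 0, and for \<open>t = 0\<close> a nonempty image forces \<open>U i\<close> to be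
      nonempty, so both weights are 1.\<close>
    proof (cases "V i = {} \<or> t = 0")
      case True
      then show ?thesis using pos by (auto simp: diam_powr_def V_def)
    next
      case False
      have "diameter (V i) powr t \<le> (C * diameter (U i) powr s) powr t"
        using V diameter_ge_0[OF V(1)] pos by (intro powr_mono2) auto
      also have "\<dots> = C powr t * diameter (U i) powr (s * t)"
        using pos by (simp add: powr_mult powr_powr)
      finally show ?thesis
        using False pos by (auto simp: diam_powr_def V_def ennreal_mult[symmetric] intro!: ennreal_leI)
    qed
  qed
  finally show ?thesis by simp
qed

lemma hausdorff_measure_eq_0_iff:
  "hausdorff_measure t X = 0 \<longleftrightarrow> (\<forall>\<delta>>0. hausdorff_premeasure \<delta> t X = 0)"
  unfolding hausdorff_measure_def by (auto simp: bot_ennreal[symmetric] SUP_bot_conv)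

text \<open>Only null sets have to be transported, since \<open>hausdorff_dim\<close> is an infimum
  over the exponents of measure zero.\<close>

lemma hausdorff_measure_image_eq_0:
  fixes f :: "'a::metric_space \<Rightarrow> 'b::metric_space"
  assumes f: "\<And>x y. x \<in> X \<Longrightarrow> y \<in> X \<Longrightarrow> dist (f x) (f y) \<le> C * dist x y powr s"
    and pos: "s > 0" "C > 0" "t \<ge> 0" and null: "hausdorff_measure (s * t) X = 0"
  shows "hausdorff_measure t (f ` X) = 0"
  unfolding hausdorff_measure_eq_0_iff
proof (intro allI impI)
  fix \<delta> :: real assume "\<delta> > 0"
  \<comment> \<open>This value solves \<open>C * \<delta>' powr s = \<delta>\<close>.\<close>
  define \<delta>' where "\<delta>' = (\<delta> / C) powr (1 / s)"
  have \<delta>': "\<delta>' > 0" "C * \<delta>' powr s \<le> \<delta>"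
    using \<open>\<delta> > 0\<close> pos by (auto simp: \<delta>'_def powr_powr)
  have zero: "hausdorff_premeasure \<delta>' (s * t) X = 0"
    using null \<delta>' unfolding hausdorff_measure_eq_0_iff by blast
  have "hausdorff_premeasure \<delta> t (f ` X) \<le> 0 + ennreal e" if "e > 0" for e :: real
  proof -
    \<comment> \<open>Dividing by \<open>C powr t\<close> compensates the factor lost when the cover
      is pushed forward.\<close>
    have "hausdorff_premeasure \<delta>' (s * t) X < ennreal (e / C powr t)"
      using zero that pos by simp
    then obtain U where U: "X \<subseteq> (\<Union>i::nat. U i)" "\<And>i. bounded (U i)" "\<And>i. diameter (U i) \<le> \<delta>'"
      and lt: "(\<Sum>i. diam_powr (s * t) (U i)) < ennreal (e / C powr t)"
      unfolding hausdorff_premeasure_def INF_less_iff by auto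
    have "hausdorff_premeasure \<delta> t (f ` X) \<le> ennreal (C powr t) * (\<Sum>i. diam_powr (s * t) (U i))"
      using hausdorff_premeasure_image_le[OF f pos \<delta>'(2) U] .
    also have "\<dots> \<le> ennreal (C powr t) * ennreal (e / C powr t)"
      using lt by (intro mult_left_mono) auto
    also have "\<dots> = ennreal e"
      using pos that by (simp add: ennreal_mult[symmetric])
    finally show ?thesis by simp
  qed
  then show "hausdorff_premeasure \<delta> t (f ` X) = 0"
    using ennreal_le_epsilon[of 0 "hausdorff_premeasure \<delta> t (f ` X)"] by auto
qed

text \<open>The map turns a null exponent \<open>a\<close> of \<open>X\<close> into
  \<open>a / s\<close> for \<open>Y\<close>, and its inverse turns \<open>b\<close> into
  \<open>s * b\<close>, so the two sets of null exponents differ by the factor \<open>s\<close>. The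
  assumption \<open>fin\<close> keeps both infima away from the empty set.\<close>

lemma hausdorff_dim_bi_hoelder:
  fixes X :: "'a::euclidean_space set" and Y :: "'b::euclidean_space set"
  assumes f: "bi_hoelder_map s C f X Y" and pos: "s > 0" "C > 0"
    and fin: "\<exists>a\<ge>0. hausdorff_measure a X = 0"
  shows "hausdorff_dim X = s * hausdorff_dim Y"
proof -
  have fXY: "f ` X = Y" "inv_into X f ` Y = X"
    using f bij_betw_inv_into[of f X Y] unfolding bi_hoelder_map_def bij_betw_def by auto
  have g: "bi_hoelder_map (1 / s) (C powr (1 / s)) (inv_into X f) Y X"
    using bi_hoelder_map_inv_into[OF f pos] .
  have 1: "hausdorff_measure (a / s) Y = 0" if "a \<ge> 0" "hausdorff_measure a X = 0" for a
    using hausdorff_measure_image_eq_0[of X f C s "a / s"] f pos that fXY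
    unfolding bi_hoelder_map_def by auto
  have 2: "hausdorff_measure (s * b) X = 0" if "b \<ge> 0" "hausdorff_measure b Y = 0" for b
    using hausdorff_measure_image_eq_0[of Y "inv_into X f" "C powr (1 / s)" "1 / s" "s * b"]
      g pos that fXY unfolding bi_hoelder_map_def by auto
  let ?A = "{a. 0 \<le> a \<and> hausdorff_measure a X = 0}" and ?B = "{b. 0 \<le> b \<and> hausdorff_measure b Y = 0}"
  have bdd: "bdd_below ?A" "bdd_below ?B" by (auto intro: bdd_belowI[of _ 0])
  have ne: "?A \<noteq> {}" "?B \<noteq> {}"
    using fin 1 pos divide_nonneg_pos by blast+
  have "s * Inf ?B \<le> Inf ?A"
  proof (rule cInf_greatest[OF ne(1)])
    fix a assume "a \<in> ?A"
    then have "Inf ?B \<le> a / s" using 1 pos by (intro cInf_lower bdd) auto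
    then show "s * Inf ?B \<le> a" using pos by (simp add: field_simps)
  qed
  moreover have "Inf ?A / s \<le> Inf ?B"
  proof (rule cInf_greatest[OF ne(2)])
    fix b assume "b \<in> ?B"
    then have "Inf ?A \<le> s * b" using 2 pos by (intro cInf_lower bdd) auto
    then show "Inf ?A / s \<le> b" using pos by (simp add: field_simps)
  qed
  ultimately show ?thesis
    using pos by (simp add: hausdorff_dim_def field_simps)
qed


section \<open>Separated self-similar sets\<close>

text \<open>The size of the ratios is left open here, so that the locale already applies to
  \<open>E'\<close>, whose ratios \<open>r j powr s\<close> are known to be below 1 only after
  \<open>s > 0\<close> has been shown.\<close>

locale separated_ifs =
  fixes m :: nat and r :: "nat \<Rightarrow> real" and \<phi> :: "nat \<Rightarrow> 'a::euclidean_space \<Rightarrow> 'a"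
    and K :: "'a set"
  assumes sim: "j \<in> {1..m} \<Longrightarrow> similitude (r j) (\<phi> j)"
    and nonempty: "K \<noteq> {}" and compact: "compact K"
    and invariant: "K = (\<Union>j\<in>{1..m}. \<phi> j ` K)"
    and disj: "i \<in> {1..m} \<Longrightarrow> j \<in> {1..m} \<Longrightarrow> i \<noteq> j \<Longrightarrow> \<phi> i ` K \<inter> \<phi> j ` K = {}"

lemma self_similar_setsE:
  assumes "K \<in> self_similar_sets m r"
  obtains \<phi> where "separated_ifs m r \<phi> K"
proof -
  from assms obtain \<phi> where sim: "\<forall>j\<in>{1..m}. similitude (r j) (\<phi> j)"
      and inv: "invariant_compact m \<phi> K"
      and disj: "\<forall>i\<in>{1..m}. \<forall>j\<in>{1..m}. i \<noteq> j \<longrightarrow> \<phi> i ` K \<inter> \<phi> j ` K = {}"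
    unfolding self_similar_sets_def mem_Collect_eq by (elim exE conjE) (rule that)
  note inv = inv[unfolded invariant_compact_def]
  have "separated_ifs m r \<phi> K"
  proof (rule separated_ifs.intro)
    show "K \<noteq> {}" "compact K" "K = (\<Union>j\<in>{1..m}. \<phi> j ` K)"
      by (rule inv[THEN conjunct1] inv[THEN conjunct2, THEN conjunct1] inv[THEN conjunct2, THEN conjunct2])+
    show "similitude (r j) (\<phi> j)" if "j \<in> {1..m}" for j
      using sim that by (rule bspec)
    show "\<phi> i ` K \<inter> \<phi> j ` K = {}" if "i \<in> {1..m}" "j \<in> {1..m}" "i \<noteq> j" for i j
      using disj[THEN bspec, OF that(1), THEN bspec, OF that(2)] that(3) by (rule mp)
  qed
  then show thesis by (rule that)
qed

context separated_ifs
begin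

lemma dist_\<phi>: "j \<in> {1..m} \<Longrightarrow> dist (\<phi> j x) (\<phi> j y) = r j * dist x y"
  using sim unfolding similitude_def by blast

lemma \<phi>_in: "j \<in> {1..m} \<Longrightarrow> x \<in> K \<Longrightarrow> \<phi> j x \<in> K"
  using invariant by blast

lemma continuous_\<phi>: "j \<in> {1..m} \<Longrightarrow> continuous_on A (\<phi> j)"
  \<comment> \<open>A Lipschitz constant must be nonnegative, and the sign of \<open>r j\<close> is
    not fixed in this locale.\<close>
  by (rule lipschitz_on_continuous_on[of "\<bar>r j\<bar>"])
    (auto simp: dist_\<phi> intro!: lipschitz_onI mult_right_mono)

text \<open>Disjoint compact sets have positive distance, and there are only finitely many pairs of
  first-level pieces.\<close>

lemma gap: "\<exists>c>0. \<forall>i\<in>{1..m}. \<forall>j\<in>{1..m}. \<forall>x\<in>K. \<forall>y\<in>K. i \<noteq> j \<longrightarrow> c \<le> dist (\<phi> i x) (\<phi> j y)"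
proof -
  let ?I = "{1..m} \<times> {1..m}"
  have "\<exists>c>0. \<forall>x\<in>K. \<forall>y\<in>K. i \<noteq> j \<longrightarrow> c \<le> dist (\<phi> i x) (\<phi> j y)"
    if ij: "i \<in> {1..m}" "j \<in> {1..m}" for i j
  proof (cases "i = j")
    case True
    then show ?thesis by (auto intro: exI[of _ 1])
  next
    case False
    have "compact (\<phi> i ` K)" "compact (\<phi> j ` K)"
      using compact continuous_\<phi> ij by (auto intro: compact_continuous_image)
    then obtain c where "c > 0" "\<And>x y. x \<in> \<phi> i ` K \<Longrightarrow> y \<in> \<phi> j ` K \<Longrightarrow> c \<le> dist x y"
      using separate_compact_closed[of "\<phi> i ` K" "\<phi> j ` K"] disj[OF ij False] compact_imp_closed
      by metis
    then show ?thesis by blast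
  qed
  then obtain c where c: "\<And>i j. i \<in> {1..m} \<Longrightarrow> j \<in> {1..m} \<Longrightarrow> c i j > 0"
      "\<And>i j x y. i \<in> {1..m} \<Longrightarrow> j \<in> {1..m} \<Longrightarrow> x \<in> K \<Longrightarrow> y \<in> K \<Longrightarrow> i \<noteq> j \<Longrightarrow> c i j \<le> dist (\<phi> i x) (\<phi> j y)"
    by metis
  \<comment> \<open>The extra element 1 makes the set nonempty for every \<open>m\<close>.\<close>
  define d where "d = Min (insert 1 (case_prod c ` ?I))"
  have "d > 0" unfolding d_def using c(1) by (subst Min_gr_iff) auto
  moreover have "d \<le> c i j" if "i \<in> {1..m}" "j \<in> {1..m}" for i j
    unfolding d_def using that by (intro Min_le) (auto intro!: image_eqI[of _ _ "(i, j)"])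
  ultimately show ?thesis
    using c(2) by (meson order_trans)
qed

text \<open>
  If \<open>r 1 \<ge> 1\<close>, the \<open>\<phi> 1\<close>-orbit of a point of \<open>\<phi> 2 ` K\<close> is uniformly separated, which is
  impossible in a compact set.
\<close>

lemma ratio_less_1:
  assumes "m \<ge> 2"
  shows "r 1 < 1"
proof (rule ccontr)
  assume "\<not> r 1 < 1"
  have 12: "1 \<in> {1..m}" "2 \<in> {1..m}" using assms by auto
  obtain c where "c > 0" and c: "\<And>x y. x \<in> K \<Longrightarrow> y \<in> K \<Longrightarrow> c \<le> dist (\<phi> 1 x) (\<phi> 2 y)"
    using gap 12 by (metis num.distinct(1) one_eq_numeral_iff)
  obtain x0 where "x0 \<in> K" using nonempty by blast
  define z where "z k = (\<phi> 1 ^^ k) (\<phi> 2 x0)" for k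
  have z: "z k \<in> K" for k
    unfolding z_def using \<open>x0 \<in> K\<close> \<phi>_in 12 by (induction k) auto
  \<comment> \<open>At \<open>k = 0\<close> this is the gap between the pieces of
    \<open>\<phi> 1\<close> and \<open>\<phi> 2\<close>. Applying \<open>\<phi> 1\<close> to both
    points cannot bring them closer when \<open>r 1 \<ge> 1\<close>.\<close>
  have dz: "c \<le> dist (z (k + Suc l)) (z k)" for k l
  proof (induction k)
    case 0
    show ?case using c[OF z[of l] \<open>x0 \<in> K\<close>] by (simp add: z_def)
  next
    case (Suc k)
    have "dist (z (Suc k + Suc l)) (z (Suc k)) = r 1 * dist (z (k + Suc l)) (z k)"
      using dist_\<phi>[OF 12(1)] by (simp add: z_def)
    also have "\<dots> \<ge> 1 * dist (z (k + Suc l)) (z k)"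
      using \<open>\<not> r 1 < 1\<close> by (intro mult_right_mono) auto
    finally show ?case using Suc by simp
  qed
  obtain l \<rho> where "strict_mono (\<rho> :: nat \<Rightarrow> nat)" "(z \<circ> \<rho>) \<longlonglongrightarrow> l"
    using compact z by (metis compact_def)
  then obtain N where "\<And>p q. p \<ge> N \<Longrightarrow> q \<ge> N \<Longrightarrow> dist (z (\<rho> p)) (z (\<rho> q)) < c"
    using LIMSEQ_imp_Cauchy[of "z \<circ> \<rho>" l] \<open>c > 0\<close> unfolding Cauchy_def by fastforce
  then have "dist (z (\<rho> (Suc N))) (z (\<rho> N)) < c" by simp
  moreover have "\<rho> N < \<rho> (Suc N)" using \<open>strict_mono \<rho>\<close> by (simp add: strict_mono_def)
  then obtain l where "\<rho> (Suc N) = \<rho> N + Suc l" using less_imp_Suc_add by fastforce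
  ultimately show False using dz[of "\<rho> N" l] by simp
qed

end

section \<open>Contracting systems and an upper bound for the dimension\<close>

locale contracting_separated_ifs = separated_ifs +
  assumes ratio: "j \<in> {1..m} \<Longrightarrow> r j \<in> {0<..<1}"
begin

lemma m_pos: "m > 0"
  using nonempty invariant by (cases "m = 0") auto

lemma uniform_ratio: "\<exists>R\<in>{0<..<1}. \<forall>j\<in>{1..m}. r j \<le> R"
proof (intro bexI ballI)
  show "Max (r ` {1..m}) \<in> {0<..<1}"
    using ratio m_pos by (auto simp: Max_gr_iff intro!: bexI[of _ 1])
qed auto

text \<open>The set is covered by at most \<open>m ^ k\<close> pieces of diameter at most
  \<open>R ^ k * D\<close>. For an exponent \<open>a\<close> with \<open>m * R powr a < 1\<close>
  their total weight tends to 0. This supplies the nonemptiness required by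
  \<open>hausdorff_dim_bi_hoelder\<close>.\<close>

lemma hausdorff_measure_null: "\<exists>a\<ge>0. hausdorff_measure a K = 0"
proof -
  obtain R where R: "0 < R" "R < 1" and rR: "\<And>j. j \<in> {1..m} \<Longrightarrow> r j \<le> R"
    using uniform_ratio by auto
  define D where "D = diameter K"
  have D: "D \<ge> 0" unfolding D_def using compact compact_imp_bounded diameter_ge_0 by blast
  have cover: "\<exists>\<U>. finite \<U> \<and> card \<U> \<le> m ^ k \<and> K \<subseteq> \<Union>\<U> \<and>
      (\<forall>U\<in>\<U>. bounded U \<and> diameter U \<le> R ^ k * D)" for k
  proof (induction k)
    case 0
    show ?case
      using compact compact_imp_bounded by (intro exI[of _ "{K}"]) (auto simp: D_def)
  next
    case (Suc k)
    then obtain \<U> where fin: "finite \<U>" and card: "card \<U> \<le> m ^ k" and sub: "K \<subseteq> \<Union>\<U>"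
      and U: "\<And>U. U \<in> \<U> \<Longrightarrow> bounded U" "\<And>U. U \<in> \<U> \<Longrightarrow> diameter U \<le> R ^ k * D" by blast
    define \<V> where "\<V> = (\<lambda>(j, U). \<phi> j ` U) ` ({1..m} \<times> \<U>)"
    have "card \<V> \<le> card ({1..m} \<times> \<U>)"
      unfolding \<V>_def using fin by (intro card_image_le) auto
    also have "\<dots> \<le> m ^ Suc k" using card by (simp add: card_cartesian_product)
    finally have "card \<V> \<le> m ^ Suc k" .
    moreover have "K \<subseteq> \<Union>\<V>"
    proof
      fix x assume "x \<in> K"
      then obtain j y where "j \<in> {1..m}" "y \<in> K" "x = \<phi> j y" using invariant by blast
      moreover from this sub obtain U where "U \<in> \<U>" "y \<in> U" by blast
      ultimately show "x \<in> \<Union>\<V>" unfolding \<V>_def by (intro UnionI[of "\<phi> j ` U"]) auto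
    qed
    moreover have "bounded V \<and> diameter V \<le> R ^ Suc k * D" if "V \<in> \<V>" for V
    proof -
      obtain j W where jW: "j \<in> {1..m}" "W \<in> \<U>" "V = \<phi> j ` W"
        using \<open>V \<in> \<V>\<close> unfolding \<V>_def by auto
      have "dist x y \<le> R ^ Suc k * D" if xy: "x \<in> V" "y \<in> V" for x y
      proof -
        obtain u v where uv: "u \<in> W" "v \<in> W" "x = \<phi> j u" "y = \<phi> j v" using xy jW by blast
        have "dist x y = r j * dist u v" using uv dist_\<phi> jW by simp
        also have "\<dots> \<le> R * (R ^ k * D)"
          using rR jW R diameter_bounded_bound[OF U(1) uv(1,2)] U(2)[OF jW(2)]
          by (intro mult_mono) (auto intro: order_trans)
        finally show ?thesis by simp
      qed
      then show ?thesis using diameter_le_metric[of "R ^ Suc k * D" V] R D by auto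
    qed
    ultimately show ?case using fin by (intro exI[of _ \<V>]) (auto simp: \<V>_def)
  qed
  obtain p where p: "R ^ p < 1 / (2 * real m)"
    using real_arch_pow_inv[of "1 / (2 * real m)" R] R m_pos by auto
  \<comment> \<open>The successor makes \<open>a\<close> positive, which avoids the special weight
    at exponent 0, and \<open>R ^ Suc p\<close> is still below the bound on
    \<open>R ^ p\<close>.\<close>
  define a where "a = real (Suc p)"
  define q where "q = real m * R powr a"
  have "R powr a = R ^ Suc p" unfolding a_def using R powr_realpow by blast
  also have "\<dots> < 1 / (2 * real m)"
    using p R power_decreasing[of p "Suc p" R] by linarith
  finally have q: "0 \<le> q" "q < 1" using m_pos by (auto simp: q_def field_simps)
  have a: "a > 0" by (simp add: a_def)
  have pre: "hausdorff_premeasure \<delta> a K \<le> ennreal (q ^ k * D powr a)" if "R ^ k * D \<le> \<delta>" for k \<delta>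
  proof -
    obtain \<U> where fin: "finite \<U>" and card: "card \<U> \<le> m ^ k" and sub: "K \<subseteq> \<Union>\<U>"
      and U: "\<And>U. U \<in> \<U> \<Longrightarrow> bounded U" "\<And>U. U \<in> \<U> \<Longrightarrow> diameter U \<le> R ^ k * D"
      using cover[of k] by blast
    obtain h where h: "bij_betw h {0..<card \<U>} \<U>" using ex_bij_betw_nat_finite[OF fin] by blast
    \<comment> \<open>Padding with empty sets turns the finite family into a sequence. They have
      weight 0, so the series reduces to a finite sum.\<close>
    define V where "V i = (if i < card \<U> then h i else {})" for i
    have hU: "h i \<in> \<U>" if "i < card \<U>" for i using h that by (auto dest: bij_betw_apply)
    have "\<Union>\<U> \<subseteq> (\<Union>i. V i)"
    proof
      fix x assume "x \<in> \<Union>\<U>"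
      then obtain U where "U \<in> \<U>" "x \<in> U" by blast
      moreover from h have "h ` {0..<card \<U>} = \<U>" by (rule bij_betw_imp_surj_on)
      ultimately obtain i where "i < card \<U>" "U = h i" by (metis atLeastLessThan_iff imageE)
      with \<open>x \<in> U\<close> show "x \<in> (\<Union>i. V i)" by (auto simp: V_def)
    qed
    with sub have "K \<subseteq> (\<Union>i. V i)" by blast
    moreover have "0 \<le> R ^ k * D" using R D by simp
    then have "bounded (V i) \<and> diameter (V i) \<le> \<delta>" for i
      using U[OF hU, of i] \<open>R ^ k * D \<le> \<delta>\<close> by (auto simp: V_def)
    ultimately have "hausdorff_premeasure \<delta> a K \<le> (\<Sum>i. diam_powr a (V i))"
      unfolding hausdorff_premeasure_def by (intro INF_lower) blast
    also have "\<dots> = (\<Sum>i<card \<U>. diam_powr a (V i))"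
      by (rule suminf_finite) (auto simp: V_def diam_powr_def)
    also have "\<dots> \<le> (\<Sum>i<card \<U>. ennreal ((R ^ k * D) powr a))"
    proof (rule sum_mono)
      fix i assume "i \<in> {..<card \<U>}"
      then have "diameter (V i) powr a \<le> (R ^ k * D) powr a"
        using U hU a diameter_ge_0 by (intro powr_mono2) (auto simp: V_def)
      then show "diam_powr a (V i) \<le> ennreal ((R ^ k * D) powr a)"
        using a by (auto simp: diam_powr_def intro: ennreal_leI)
    qed
    also have "\<dots> = ennreal (real (card \<U>) * (R ^ k * D) powr a)"
      by (simp add: ennreal_mult ennreal_of_nat_eq_real_of_nat)
    also have "\<dots> \<le> ennreal (real (m ^ k) * (R ^ k * D) powr a)"
      using card by (intro ennreal_leI mult_right_mono) (auto simp del: of_nat_power)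
    also have "real (m ^ k) * (R ^ k * D) powr a = q ^ k * D powr a"
    proof -
      have "(R ^ k) powr a = (R powr a) ^ k"
        using R by (simp add: powr_realpow[symmetric] powr_powr mult.commute)
      then show ?thesis using R D by (simp add: q_def powr_mult power_mult_distrib)
    qed
    finally show ?thesis .
  qed
  have "hausdorff_premeasure \<delta> a K = 0" if "\<delta> > 0" for \<delta>
  proof -
    \<comment> \<open>For fixed \<open>\<delta>\<close> every sufficiently deep level is an
      admissible cover, so \<open>k\<close> may tend to infinity in the bound
      \<open>pre\<close>.\<close>
    have "(\<lambda>k. R ^ k * D) \<longlonglongrightarrow> 0 * D" using R by (intro tendsto_intros LIMSEQ_power_zero) auto
    then have "\<forall>\<^sub>F k in sequentially. R ^ k * D < \<delta>" using that by (intro order_tendstoD(2)) auto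
    then have ev: "\<forall>\<^sub>F k in sequentially. hausdorff_premeasure \<delta> a K \<le> ennreal (q ^ k * D powr a)"
      by eventually_elim (rule pre, simp)
    have "(\<lambda>k. ennreal (q ^ k * D powr a)) \<longlonglongrightarrow> ennreal (0 * D powr a)"
      using q by (intro tendsto_intros LIMSEQ_power_zero) auto
    from tendsto_lowerbound[OF this ev] show ?thesis by simp
  qed
  then have "hausdorff_measure a K = 0" unfolding hausdorff_measure_eq_0_iff by blast
  then show ?thesis using a by (intro exI[of _ a]) auto
qed

section \<open>Symbolic coding of the points\<close>

primrec cyl :: "(nat \<Rightarrow> nat) \<Rightarrow> nat \<Rightarrow> 'a \<Rightarrow> 'a" where
  "cyl \<sigma> 0 = id"
| "cyl \<sigma> (Suc k) = cyl \<sigma> k \<circ> \<phi> (\<sigma> k)"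

abbreviation codes :: "(nat \<Rightarrow> nat) set" where
  "codes \<equiv> UNIV \<rightarrow> {1..m}"

lemma dist_cyl: "\<sigma> \<in> codes \<Longrightarrow> dist (cyl \<sigma> k x) (cyl \<sigma> k y) = (\<Prod>i<k. r (\<sigma> i)) * dist x y"
proof (induction k arbitrary: x y)
  case (Suc k)
  then have "\<sigma> k \<in> {1..m}" by blast
  then show ?case using Suc by (simp add: dist_\<phi>)
qed simp

text \<open>A new letter is composed on the inside, so extending the prefix shrinks the
  image.\<close>

lemma cyl_image_Suc: "\<sigma> \<in> codes \<Longrightarrow> cyl \<sigma> (Suc k) ` K \<subseteq> cyl \<sigma> k ` K"
  using \<phi>_in by (auto simp: Pi_iff)

lemma cyl_cong: "(\<And>i. i < k \<Longrightarrow> \<sigma> i = \<tau> i) \<Longrightarrow> cyl \<sigma> k = cyl \<tau> k"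
  by (induction k) auto

lemma continuous_cyl: "\<sigma> \<in> codes \<Longrightarrow> continuous_on A (cyl \<sigma> k)"
proof (induction k arbitrary: A)
  case (Suc k)
  then have "\<sigma> k \<in> {1..m}" by blast
  then show ?case using Suc continuous_\<phi> unfolding cyl.simps by (blast intro: continuous_on_compose)
qed auto

text \<open>The choice is in fact unique for \<open>\<sigma> \<in> codes\<close>: existence follows
  from compactness, uniqueness from contraction.\<close>

definition code_point :: "(nat \<Rightarrow> nat) \<Rightarrow> 'a" where
  "code_point \<sigma> = (SOME x. \<forall>k. x \<in> cyl \<sigma> k ` K)"

text \<open>The images form a decreasing sequence of nonempty compact sets, which has a common
  point.\<close>

lemma code_point:
  assumes "\<sigma> \<in> codes"
  shows "code_point \<sigma> \<in> cyl \<sigma> k ` K"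
proof -
  have "\<Inter>(range (\<lambda>k. cyl \<sigma> k ` K)) \<noteq> {}"
  proof (rule compact_nest)
    show "cyl \<sigma> l ` K \<subseteq> cyl \<sigma> k ` K" if "k \<le> l" for k l
      using that by (rule lift_Suc_antimono_le[rotated]) (rule cyl_image_Suc[OF assms])
  qed (use compact nonempty continuous_cyl[OF assms] in \<open>auto intro: compact_continuous_image\<close>)
  then have "\<exists>x. \<forall>k. x \<in> cyl \<sigma> k ` K" by blast
  then show ?thesis unfolding code_point_def by (rule someI2_ex) blast
qed

text \<open>Two points common to all images lie within \<open>R ^ k * diameter K\<close> of each
  other for every \<open>k\<close>.\<close>

lemma code_point_unique:
  assumes \<sigma>: "\<sigma> \<in> codes" and x: "\<And>k. x \<in> cyl \<sigma> k ` K"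
  shows "code_point \<sigma> = x"
proof -
  obtain R where R: "0 < R" "R < 1" and rR: "\<And>j. j \<in> {1..m} \<Longrightarrow> r j \<le> R"
    using uniform_ratio by auto
  have le: "dist (code_point \<sigma>) x \<le> R ^ k * diameter K" for k
  proof -
    obtain u v where uv: "u \<in> K" "v \<in> K" "code_point \<sigma> = cyl \<sigma> k u" "x = cyl \<sigma> k v"
      using code_point[OF \<sigma>, of k] x[of k] by blast
    have "(\<Prod>i<k. r (\<sigma> i)) \<le> (\<Prod>i<k. R)"
      using rR \<sigma> ratio by (intro prod_mono) (auto simp: Pi_iff intro: less_imp_le)
    moreover have "dist u v \<le> diameter K"
      using uv compact compact_imp_bounded diameter_bounded_bound by blast
    ultimately show ?thesis
      using uv R by (auto simp: dist_cyl[OF \<sigma>] intro!: mult_mono)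
  qed
  have "(\<lambda>k. R ^ k * diameter K) \<longlonglongrightarrow> 0 * diameter K"
    using R by (intro tendsto_intros LIMSEQ_power_zero) auto
  then have "dist (code_point \<sigma>) x \<le> 0"
    by (intro tendsto_lowerbound[where f = "\<lambda>k. R ^ k * diameter K" and F = sequentially])
      (use le in auto)
  then show ?thesis by simp
qed

text \<open>Invariance allows \<open>x\<close> to be pulled back through one map after another, and
  the indices of these maps form a code of \<open>x\<close>.\<close>

lemma code_point_surj:
  assumes "x \<in> K"
  shows "\<exists>\<sigma>\<in>codes. code_point \<sigma> = x"
proof -
  \<comment> \<open>Dependent choice of the successive preimages; the clause for
    \<open>k = 0\<close> fixes the starting point.\<close>
  have "\<exists>y. \<forall>k. (y k \<in> K \<and> (k = 0 \<longrightarrow> y k = x)) \<and> (\<exists>j\<in>{1..m}. y k = \<phi> j (y (Suc k)))"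
    by (rule dependent_nat_choice[where P = "\<lambda>k z. z \<in> K \<and> (k = 0 \<longrightarrow> z = x)"
            and Q = "\<lambda>k z z'. \<exists>j\<in>{1..m}. z = \<phi> j z'"])
      (use assms invariant in blast)+
  then obtain y where y: "\<And>k. y k \<in> K" "y 0 = x" "\<And>k. \<exists>j\<in>{1..m}. y k = \<phi> j (y (Suc k))"
    by blast
  then obtain \<sigma> where \<sigma>: "\<And>k. \<sigma> k \<in> {1..m}" "\<And>k. y k = \<phi> (\<sigma> k) (y (Suc k))" by metis
  have "x = cyl \<sigma> k (y k)" for k
    by (induction k) (simp_all add: y(2) flip: \<sigma>(2))
  then have "x \<in> cyl \<sigma> k ` K" for k using y(1) by blast
  then show ?thesis using code_point_unique[of \<sigma>] \<sigma>(1) by blast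
qed

text \<open>Here \<open>k\<close> is the first place where the codes differ. The common prefix
  scales distances by exactly the product of its ratios, and what remains is a distance between two
  different first-level pieces, bounded below by the gap and above by the diameter.\<close>

lemma dist_code_point:
  "\<exists>C>0. \<forall>\<sigma>\<in>codes. \<forall>\<tau>\<in>codes. \<forall>k. (\<forall>i<k. \<sigma> i = \<tau> i) \<and> \<sigma> k \<noteq> \<tau> k \<longrightarrow>
     inverse C * (\<Prod>i<k. r (\<sigma> i)) \<le> dist (code_point \<sigma>) (code_point \<tau>) \<and>
     dist (code_point \<sigma>) (code_point \<tau>) \<le> C * (\<Prod>i<k. r (\<sigma> i))"
proof -
  obtain c where c: "c > 0" "\<And>i j x y. i \<in> {1..m} \<Longrightarrow> j \<in> {1..m} \<Longrightarrow> x \<in> K \<Longrightarrow> y \<in> K \<Longrightarrow> i \<noteq> j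
      \<Longrightarrow> c \<le> dist (\<phi> i x) (\<phi> j y)"
    using gap by blast
  define C where "C = max (diameter K) (inverse c)"
  have C: "C > 0" "diameter K \<le> C" "inverse C \<le> c"
    using c(1) by (auto simp: C_def less_max_iff_disj intro: inverse_le_imp_le)
  have "inverse C * (\<Prod>i<k. r (\<sigma> i)) \<le> dist (code_point \<sigma>) (code_point \<tau>) \<and>
     dist (code_point \<sigma>) (code_point \<tau>) \<le> C * (\<Prod>i<k. r (\<sigma> i))"
    if \<sigma>: "\<sigma> \<in> codes" and \<tau>: "\<tau> \<in> codes" and eq: "\<And>i. i < k \<Longrightarrow> \<sigma> i = \<tau> i" and ne: "\<sigma> k \<noteq> \<tau> k"
    for \<sigma> \<tau> k
  proof -
    have in_m: "\<sigma> k \<in> {1..m}" "\<tau> k \<in> {1..m}" using \<sigma> \<tau> by blast+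
    obtain u where u: "u \<in> K" "code_point \<sigma> = cyl \<sigma> k (\<phi> (\<sigma> k) u)"
      using code_point[OF \<sigma>, of "Suc k"] by auto
    \<comment> \<open>Since the prefixes agree, the point of \<open>\<tau>\<close> can be written
      with the map of \<open>\<sigma>\<close>, so that one similarity acts on both points.\<close>
    obtain v where v: "v \<in> K" "code_point \<tau> = cyl \<sigma> k (\<phi> (\<tau> k) v)"
      using code_point[OF \<tau>, of "Suc k"] cyl_cong[of k \<sigma> \<tau>] eq by auto
    have d: "dist (code_point \<sigma>) (code_point \<tau>)
        = (\<Prod>i<k. r (\<sigma> i)) * dist (\<phi> (\<sigma> k) u) (\<phi> (\<tau> k) v)"
      unfolding u(2) v(2) using dist_cyl[OF \<sigma>] by blast
    have P: "0 \<le> (\<Prod>i<k. r (\<sigma> i))"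
      using \<sigma> ratio by (intro prod_nonneg) (auto simp: Pi_iff intro: less_imp_le)
    have "inverse C \<le> dist (\<phi> (\<sigma> k) u) (\<phi> (\<tau> k) v)"
      using c(2)[OF in_m u(1) v(1) ne] C by linarith
    moreover have "dist (\<phi> (\<sigma> k) u) (\<phi> (\<tau> k) v) \<le> C"
      using diameter_bounded_bound[OF compact_imp_bounded[OF compact] \<phi>_in[OF in_m(1) u(1)]
          \<phi>_in[OF in_m(2) v(1)]] C by linarith
    ultimately show ?thesis
      using P unfolding d by (metis mult.commute mult_left_mono)
  qed
  then show ?thesis using C(1) by blast
qed

text \<open>Injectivity comes from the lower bound at the first differing letter, where the product
  of ratios is positive.\<close>

lemma bij_betw_code_point: "bij_betw code_point codes K"
  unfolding bij_betw_def
proof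
  show "code_point ` codes = K"
    using code_point[of _ 0] code_point_surj by fastforce
  show "inj_on code_point codes"
  proof (rule inj_onI, rule ccontr)
    fix \<sigma> \<tau> assume \<sigma>: "\<sigma> \<in> codes" and \<tau>: "\<tau> \<in> codes" and eq: "code_point \<sigma> = code_point \<tau>" and "\<sigma> \<noteq> \<tau>"
    then have "\<exists>k. \<sigma> k \<noteq> \<tau> k" by blast
    then obtain k where "\<sigma> k \<noteq> \<tau> k" "\<forall>i<k. \<sigma> i = \<tau> i"
      using exists_least_iff[of "\<lambda>k. \<sigma> k \<noteq> \<tau> k"] by blast
    with dist_code_point \<sigma> \<tau> obtain C
      where "C > 0" "inverse C * (\<Prod>i<k. r (\<sigma> i)) \<le> dist (code_point \<sigma>) (code_point \<tau>)" by blast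
    moreover have "(\<Prod>i<k. r (\<sigma> i)) > 0"
      using \<sigma> ratio by (intro prod_pos) (auto simp: Pi_iff)
    ultimately show False using eq by (simp add: mult_le_0_iff)
  qed
qed

end

text \<open>Points with the same code are matched. If \<open>P\<close> is the product of ratios
  along the common prefix, distances in \<open>K\<close> are comparable to \<open>P\<close> and
  distances in \<open>L\<close> to \<open>P powr s\<close>, because the product of the powers is the
  power of the product.\<close>

lemma bi_hoelder_map_between_codings:
  assumes K: "contracting_separated_ifs m r \<phi> K"
    and L: "contracting_separated_ifs m (\<lambda>j. r j powr s) \<psi> L"
    and s: "s > 0"
  shows "\<exists>g C. C > 0 \<and> bi_hoelder_map s C g K L"
proof -
  interpret K: contracting_separated_ifs m r \<phi> K by fact
  interpret L: contracting_separated_ifs m "\<lambda>j. r j powr s" \<psi> L by fact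
  let ?codes = "UNIV \<rightarrow> {1..m} :: (nat \<Rightarrow> nat) set"
  obtain C where C: "C > 0" and dK: "\<And>\<sigma> \<tau> k. \<sigma> \<in> ?codes \<Longrightarrow> \<tau> \<in> ?codes \<Longrightarrow> \<forall>i<k. \<sigma> i = \<tau> i \<Longrightarrow> \<sigma> k \<noteq> \<tau> k \<Longrightarrow>
     inverse C * (\<Prod>i<k. r (\<sigma> i)) \<le> dist (K.code_point \<sigma>) (K.code_point \<tau>) \<and>
     dist (K.code_point \<sigma>) (K.code_point \<tau>) \<le> C * (\<Prod>i<k. r (\<sigma> i))"
    using K.dist_code_point by blast
  obtain C' where C': "C' > 0" and dL: "\<And>\<sigma> \<tau> k. \<sigma> \<in> ?codes \<Longrightarrow> \<tau> \<in> ?codes \<Longrightarrow> \<forall>i<k. \<sigma> i = \<tau> i \<Longrightarrow> \<sigma> k \<noteq> \<tau> k \<Longrightarrow>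
     inverse C' * (\<Prod>i<k. r (\<sigma> i) powr s) \<le> dist (L.code_point \<sigma>) (L.code_point \<tau>) \<and>
     dist (L.code_point \<sigma>) (L.code_point \<tau>) \<le> C' * (\<Prod>i<k. r (\<sigma> i) powr s)"
    using L.dist_code_point by blast
  define h where "h = inv_into ?codes K.code_point"
  have h: "bij_betw h K ?codes"
    unfolding h_def by (rule bij_betw_inv_into[OF K.bij_betw_code_point])
  have h_inv: "K.code_point (h x) = x" if "x \<in> K" for x
    unfolding h_def using that bij_betw_inv_into_right[OF K.bij_betw_code_point] by blast
  let ?D = "C' * C powr s"
  have "bi_hoelder_map s ?D (L.code_point \<circ> h) K L"
    unfolding bi_hoelder_map_def
  proof (intro conjI ballI)
    show "bij_betw (L.code_point \<circ> h) K L"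
      using h L.bij_betw_code_point by (rule bij_betw_trans)
    fix x y assume xy: "x \<in> K" "y \<in> K"
    have "inverse ?D * dist x y powr s \<le> dist ((L.code_point \<circ> h) x) ((L.code_point \<circ> h) y) \<and>
      dist ((L.code_point \<circ> h) x) ((L.code_point \<circ> h) y) \<le> ?D * dist x y powr s"
    \<comment> \<open>Equal points have no first differing letter; there all terms vanish, as
      \<open>0 powr s = 0\<close>.\<close>
    proof (cases "x = y")
      case True
      then show ?thesis by simp
    next
      case False
      define \<sigma> \<tau> where "\<sigma> = h x" and "\<tau> = h y"
      have \<sigma>: "\<sigma> \<in> ?codes" "\<tau> \<in> ?codes"
        using xy h bij_betw_apply unfolding \<sigma>_def \<tau>_def by metis+
      have xeq: "x = K.code_point \<sigma>" "y = K.code_point \<tau>"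
        using h_inv xy by (auto simp: \<sigma>_def \<tau>_def)
      with False have "\<sigma> \<noteq> \<tau>" by blast
      then have "\<exists>k. \<sigma> k \<noteq> \<tau> k" by blast
      then obtain k where k: "\<forall>i<k. \<sigma> i = \<tau> i" "\<sigma> k \<noteq> \<tau> k"
        using exists_least_iff[of "\<lambda>k. \<sigma> k \<noteq> \<tau> k"] by blast
      define P where "P = (\<Prod>i<k. r (\<sigma> i))"
      have P: "P \<ge> 0"
        unfolding P_def using \<sigma> K.ratio by (intro prod_nonneg) (auto simp: Pi_iff intro: less_imp_le)
      have 1: "inverse C * P \<le> dist x y" "dist x y \<le> C * P"
        using dK[OF \<sigma> k] by (auto simp: P_def xeq)
      have 2: "inverse C' * P powr s \<le> dist (L.code_point \<sigma>) (L.code_point \<tau>)"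
          "dist (L.code_point \<sigma>) (L.code_point \<tau>) \<le> C' * P powr s"
        using dL[OF \<sigma> k] by (auto simp: P_def prod_powr_distrib)
      have "dist x y powr s \<le> C powr s * P powr s"
        using powr_mono2[OF _ _ 1(2), of s] s C P by (simp add: powr_mult)
      then have "inverse ?D * dist x y powr s \<le> inverse C' * P powr s"
        using C C' by (simp add: field_simps)
      moreover have "P \<le> C * dist x y" using 1(1) C by (simp add: field_simps)
      then have "P powr s \<le> C powr s * dist x y powr s"
        using powr_mono2[of s P "C * dist x y"] s C P by (simp add: powr_mult)
      then have "C' * P powr s \<le> ?D * dist x y powr s" using C' by simp
      ultimately show ?thesis using 2 by (simp add: \<sigma>_def \<tau>_def)
    qed
    then show "inverse ?D * dist x y powr s \<le> dist ((L.code_point \<circ> h) x) ((L.code_point \<circ> h) y)"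
      "dist ((L.code_point \<circ> h) x) ((L.code_point \<circ> h) y) \<le> ?D * dist x y powr s" by blast+
  qed
  moreover have "?D > 0" using C C' by simp
  ultimately show ?thesis by blast
qed

theorem theorem1p2:
  fixes m n :: nat
    and r t :: "nat \<Rightarrow> real"
    and s :: real
    and E :: "'a::euclidean_space set"
    and F :: "'b::euclidean_space set"
    and E' :: "'c::euclidean_space set"
  assumes "m \<ge> 2" and "n \<ge> 2"
    and "\<And>j. j \<in> {1..m} \<Longrightarrow> r j \<in> {0<..<1}"
    and "\<And>j. j \<in> {1..n} \<Longrightarrow> t j \<in> {0<..<1}"
    and "E \<in> self_similar_sets m r"
    and "F \<in> self_similar_sets n t"
    and "s = hausdorff_dim E / hausdorff_dim F"
    and "E' \<in> self_similar_sets m (\<lambda>j. r j powr s)"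
  shows "strictly_hoelder_equivalent E F \<longleftrightarrow> lipschitz_equivalent E' F"
proof -
  obtain \<phi> where "separated_ifs m r \<phi> E" using assms(5) by (rule self_similar_setsE)
  then have E: "contracting_separated_ifs m r \<phi> E"
    using assms(3) by (simp add: contracting_separated_ifs_def contracting_separated_ifs_axioms_def)
  obtain \<psi> where \<psi>: "separated_ifs m (\<lambda>j. r j powr s) \<psi> E'"
    using assms(8) by (rule self_similar_setsE)
  have "r 1 powr s < 1" using separated_ifs.ratio_less_1[OF \<psi> \<open>m \<ge> 2\<close>] .
  moreover have "0 < r 1" "r 1 < 1" using assms(3)[of 1] \<open>m \<ge> 2\<close> by auto
  \<comment> \<open>If \<open>s \<le> 0\<close>, then \<open>r 1 < 1\<close> would give
    \<open>r 1 powr s \<ge> 1\<close>.\<close>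
  ultimately have s: "s > 0"
    using powr_mono'[of s 0 "r 1"] by (cases "s > 0") auto
  have "r j powr s \<in> {0<..<1}" if "j \<in> {1..m}" for j
    using assms(3)[OF that] s powr_less_mono2[of s "r j" 1] by auto
  then have E': "contracting_separated_ifs m (\<lambda>j. r j powr s) \<psi> E'"
    using \<psi> by (simp add: contracting_separated_ifs_def contracting_separated_ifs_axioms_def)
  obtain g C where C: "C > 0" and g: "bi_hoelder_map s C g E E'"
    using bi_hoelder_map_between_codings[OF E E' s] by blast
  show ?thesis
  proof
    assume "strictly_hoelder_equivalent E F"
    then obtain f s' B where f: "s' > 0" "B > 0" "bi_hoelder_map s' B f E F"
      unfolding strictly_hoelder_equivalent_def by blast
    have "hausdorff_dim E = s' * hausdorff_dim F"
      using hausdorff_dim_bi_hoelder[OF f(3,1,2)]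
        contracting_separated_ifs.hausdorff_measure_null[OF E] by blast
    \<comment> \<open>Division by zero yields 0, so a vanishing denominator would contradict
      \<open>s > 0\<close>. Cancelling the dimension of \<open>F\<close> then identifies the
      exponent \<open>s'\<close>.\<close>
    moreover have "hausdorff_dim F \<noteq> 0" using s assms(7) by auto
    ultimately have "s' = s" using assms(7) by simp
    \<comment> \<open>The inverse of \<open>g\<close> has exponent \<open>1 / s\<close> and
      \<open>f\<close> has exponent \<open>s\<close>, so the composite has exponent 1.\<close>
    then have "bi_hoelder_map 1 (B * (C powr (1 / s)) powr s) (f \<circ> inv_into E g) E' F"
      using bi_hoelder_map_comp[OF bi_hoelder_map_inv_into[OF g s C] f(3)] s f C by simp
    then show "lipschitz_equivalent E' F"
      unfolding lipschitz_equivalent_def using f C by (metis mult_pos_pos powr_gt_zero less_irrefl)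
  next
    assume "lipschitz_equivalent E' F"
    then obtain f B where f: "B > 0" "bi_hoelder_map 1 B f E' F"
      unfolding lipschitz_equivalent_def by blast
    have "bi_hoelder_map s (B * C) (f \<circ> g) E F"
      using bi_hoelder_map_comp[OF g f(2)] f C by simp
    then show "strictly_hoelder_equivalent E F"
      unfolding strictly_hoelder_equivalent_def using s f C mult_pos_pos by blast
  qed
qed

end
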